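(* Let $m<0$. The explicit-implicit scheme $$\frac{y^{n+1}-y^n}\tau+(C^n+D+R_+^n)y^{n+1}+R_-^ny^n=0,\quad n=0,1,\dots,N_0-1,\qquad y^0=u^0,$$ is unconditionally (for every $\tau>0$) $\varrho$-stable in $H$ with $$\varrho=1-m\tau,$$ and its solution satisfies $\|y^{n+1}\|\le\varrho\|y^n\|$, $n=0,1,\dots,N_0-1$.
   Context: $H=L_2(\omega)$ is the space of real grid functions on the finite rectangular grid $\omega$ (extended by zero to the boundary nodes) with scalar product $(y,w)=\sum_{\boldsymbol x\in\omega}y(\boldsymbol x)w(\boldsymbol x)h_1h_2$ and norm $\|\cdot\|$. $\tau>0$ is the time step, $N_0\tau=T$. $D$ is a time-independent operator on $H$, $D=D^*\ge\frac{\kappa_1}{M_0}E$ with $\kappa_1,M_0>0$, $E$ the identity; $C^n$ is a (time-dependent) skew-symmetric operator, $(C^n)^*=-C^n$. $R^n$ is the multiplication (reaction) operator $(R^ny)(\boldsymbol x)=r(\boldsymbol x,t)y(\boldsymbol x)$ (with $t$ the time associated with step $n$), with $mE\le R^n\le ME$, i.e. $m\le r\le M$. It is split as $R^n=R_+^n+R_-^n$, where $R_\pm^n$ are multiplication by $r_+=\max(0,r)$ and $r_-=r-r_+$; thus $R_\pm^n$ are self-adjoint, $R_+^n\ge0$ and $mE\le R_-^n\le0$. $\varrho$-stability in $H$ means $\|y^{n+1}\|\le\varrho\|y^n\|$ for all $n$ with $\varrho^n\le m_1$ for a constant $m_1$ independent of $\tau$ and $n$. *)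

theory Defs
  imports Complex_Main
begin

type_synonym grid_fun = "real \<times> real \<Rightarrow> real"
type_synonym grid_op = "grid_fun \<Rightarrow> grid_fun"

text \<open>A uniform grid on the rectangle with sides \<open>cells1 * step1\<close> and \<open>cells2 * step2\<close>.\<close>

record rect_grid =
  step1 :: real
  step2 :: real
  cells1 :: nat
  cells2 :: nat

definition rectangular_grid :: "rect_grid \<Rightarrow> bool" where
  "rectangular_grid g \<longleftrightarrow> 0 < step1 g \<and> 0 < step2 g \<and> 2 \<le> cells1 g \<and> 2 \<le> cells2 g"

text \<open>Interior nodes only; the boundary nodes have index \<open>0\<close> or \<open>cells\<close>.\<close>

definition nodes :: "rect_grid \<Rightarrow> (real \<times> real) set" where
  "nodes g = {(real i * step1 g, real j * step2 g) | i j.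
     0 < i \<and> i < cells1 g \<and> 0 < j \<and> j < cells2 g}"

text \<open>Grid functions are extended by zero off the interior nodes, in particular to the boundary.\<close>

definition grid_space :: "rect_grid \<Rightarrow> grid_fun set" where
  "grid_space g = {y. \<forall>x. x \<notin> nodes g \<longrightarrow> y x = 0}"

definition grid_inner :: "rect_grid \<Rightarrow> grid_fun \<Rightarrow> grid_fun \<Rightarrow> real" where
  "grid_inner g y w = (\<Sum>x\<in>nodes g. y x * w x * step1 g * step2 g)"

definition grid_norm :: "rect_grid \<Rightarrow> grid_fun \<Rightarrow> real" where
  "grid_norm g y = sqrt (grid_inner g y y)"

definition linear_operator :: "rect_grid \<Rightarrow> grid_op \<Rightarrow> bool" where
  "linear_operator g A \<longleftrightarrow>
     (\<forall>y\<in>grid_space g. A y \<in> grid_space g) \<and>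
     (\<forall>y\<in>grid_space g. \<forall>w\<in>grid_space g. A (\<lambda>x. y x + w x) = (\<lambda>x. A y x + A w x)) \<and>
     (\<forall>c. \<forall>y\<in>grid_space g. A (\<lambda>x. c * y x) = (\<lambda>x. c * A y x))"

text \<open>\<open>adjoint_pair g A B\<close> says that \<open>B\<close> is the adjoint of \<open>A\<close> on the space of grid functions.\<close>

definition adjoint_pair :: "rect_grid \<Rightarrow> grid_op \<Rightarrow> grid_op \<Rightarrow> bool" where
  "adjoint_pair g A B \<longleftrightarrow>
     (\<forall>y\<in>grid_space g. \<forall>w\<in>grid_space g. grid_inner g (A y) w = grid_inner g y (B w))"

definition self_adjoint :: "rect_grid \<Rightarrow> grid_op \<Rightarrow> bool" where
  "self_adjoint g A \<longleftrightarrow> adjoint_pair g A A"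

definition skew_symmetric :: "rect_grid \<Rightarrow> grid_op \<Rightarrow> bool" where
  "skew_symmetric g A \<longleftrightarrow> adjoint_pair g A (\<lambda>y x. - A y x)"

definition op_le :: "rect_grid \<Rightarrow> grid_op \<Rightarrow> grid_op \<Rightarrow> bool" where
  "op_le g A B \<longleftrightarrow> (\<forall>y\<in>grid_space g. grid_inner g (A y) y \<le> grid_inner g (B y) y)"

definition scaled_id :: "real \<Rightarrow> grid_op" where
  "scaled_id c y = (\<lambda>x. c * y x)"

definition mult_op :: "grid_fun \<Rightarrow> grid_op" where
  "mult_op c y = (\<lambda>x. c x * y x)"

definition pos_part :: "grid_fun \<Rightarrow> grid_fun" where
  "pos_part c x = max 0 (c x)"

definition neg_part :: "grid_fun \<Rightarrow> grid_fun" where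
  "neg_part c x = c x - pos_part c x"

text \<open>
  \<open>C \<tau> n\<close> and \<open>r \<tau> n\<close> are the convection operator and the reaction coefficient that enter
  step \<open>n\<close> when the time step is \<open>\<tau>\<close>. Only \<open>y 0, \<dots>, y N\<close> are constrained.
\<close>

definition explicit_implicit_solution ::
    "rect_grid \<Rightarrow> (real \<Rightarrow> nat \<Rightarrow> grid_op) \<Rightarrow> grid_op \<Rightarrow> (real \<Rightarrow> nat \<Rightarrow> grid_fun) \<Rightarrow>
     real \<Rightarrow> nat \<Rightarrow> grid_fun \<Rightarrow> (nat \<Rightarrow> grid_fun) \<Rightarrow> bool" where
  "explicit_implicit_solution g C D r \<tau> N u y \<longleftrightarrow>
     (\<forall>n\<le>N. y n \<in> grid_space g) \<and> y 0 = u \<and>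
     (\<forall>n<N. \<forall>x\<in>nodes g.
        (y (n + 1) x - y n x) / \<tau>
        + (C \<tau> n (y (n + 1)) x + D (y (n + 1)) x + mult_op (pos_part (r \<tau> n)) (y (n + 1)) x)
        + mult_op (neg_part (r \<tau> n)) (y n) x = 0)"

text \<open>
  \<open>S \<tau> N u y\<close> says that \<open>y\<close> solves the scheme with \<open>N\<close> steps of size \<open>\<tau>\<close> and initial value
  \<open>u\<close>. The constant \<open>m1\<close> may depend on \<open>T\<close>, but is chosen before \<open>\<tau>\<close>, \<open>N\<close> and the step number;
  there is no upper bound on \<open>\<tau>\<close> other than the one implied by \<open>N * \<tau> = T\<close>.
\<close>

definition unconditionally_rho_stable ::
    "rect_grid \<Rightarrow> real \<Rightarrow> (real \<Rightarrow> real) \<Rightarrow>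
     (real \<Rightarrow> nat \<Rightarrow> grid_fun \<Rightarrow> (nat \<Rightarrow> grid_fun) \<Rightarrow> bool) \<Rightarrow> bool" where
  "unconditionally_rho_stable g T \<rho> S \<longleftrightarrow>
     (\<exists>m1. \<forall>\<tau>>0. \<forall>N. real N * \<tau> = T \<longrightarrow>
        (\<forall>n\<le>N. \<rho> \<tau> ^ n \<le> m1) \<and>
        (\<forall>u\<in>grid_space g. \<forall>y. S \<tau> N u y \<longrightarrow>
           (\<forall>n<N. grid_norm g (y (n + 1)) \<le> \<rho> \<tau> * grid_norm g (y n))))"

end

theory Submission
  imports Defs
begin

text \<open>
  Pairing the scheme with \<open>y (n + 1)\<close> removes \<open>C\<close> and leaves nonnegative contributions of \<open>D\<close> and
  of the positive part of \<open>r\<close>, so that \<open>\<parallel>y (n + 1)\<parallel>\<^sup>2\<close> is at most the inner product of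
  \<open>(1 - \<tau> * r\<^sub>-) y n\<close> with \<open>y (n + 1)\<close>. The factor \<open>1 - \<tau> * r\<^sub>-\<close> lies between \<open>1\<close> and
  \<open>1 - m * \<tau>\<close>, because an operator bound on a multiplication operator is a pointwise bound; the estimate then
  follows from \<open>2 a b \<le> a\<^sup>2 + b\<^sup>2\<close> at each node.
\<close>

lemma finite_nodes: "finite (nodes g)"
proof (rule finite_subset)
  show "nodes g \<subseteq> (\<lambda>(i, j). (real i * step1 g, real j * step2 g)) ` ({..<cells1 g} \<times> {..<cells2 g})"
    unfolding nodes_def by force
qed simp

lemma grid_inner_nonneg:
  assumes "rectangular_grid g"
  shows "0 \<le> grid_inner g y y"
  using assms unfolding grid_inner_def rectangular_grid_def by (intro sum_nonneg) simp

lemma skew_symmetric_inner_eq_0: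
  assumes "skew_symmetric g A" and "y \<in> grid_space g"
  shows "grid_inner g (A y) y = 0"
proof -
  have "grid_inner g (A y) y = grid_inner g y (\<lambda>x. - A y x)"
    using assms unfolding skew_symmetric_def adjoint_pair_def by blast
  also have "\<dots> = - grid_inner g (A y) y"
    unfolding grid_inner_def by (simp add: sum_negf mult.commute)
  finally show ?thesis by simp
qed

lemma op_le_scaled_id_nonneg:
  assumes "rectangular_grid g" and "0 \<le> c" and "op_le g (scaled_id c) A" and "y \<in> grid_space g"
  shows "0 \<le> grid_inner g (A y) y"
proof -
  have "0 \<le> c * grid_inner g y y"
    using assms grid_inner_nonneg by simp
  also have "\<dots> = grid_inner g (scaled_id c y) y"
    unfolding grid_inner_def scaled_id_def by (simp add: sum_distrib_left mult.assoc)
  also have "\<dots> \<le> grid_inner g (A y) y"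
    using assms unfolding op_le_def by blast
  finally show ?thesis .
qed

text \<open>Testing the quadratic forms on the indicator function of the node \<open>x\<close>
  leaves a single summand on each side, and the positive cell area \<open>step1 g * step2 g\<close>
  cancels.\<close>

lemma op_le_scaled_id_mult_opD:
  assumes g: "rectangular_grid g" and le: "op_le g (scaled_id c) (mult_op f)" and x: "x \<in> nodes g"
  shows "c \<le> f x"
proof -
  define e :: grid_fun where "e z = (if z = x then 1 else 0)" for z
  have inner: "grid_inner g (\<lambda>z. k z * e z) e = k x * step1 g * step2 g" for k
  proof -
    have "grid_inner g (\<lambda>z. k z * e z) e = (\<Sum>z\<in>nodes g. if z = x then k x * step1 g * step2 g else 0)"
      unfolding grid_inner_def by (intro sum.cong) (auto simp: e_def)
    then show ?thesis
      using x by (simp add: finite_nodes)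
  qed
  have "e \<in> grid_space g"
    using x by (auto simp: grid_space_def e_def)
  then have "c * step1 g * step2 g \<le> f x * step1 g * step2 g"
    using le inner[of "\<lambda>_. c"] inner[of f]
    unfolding op_le_def scaled_id_def mult_op_def by metis
  then show ?thesis
    using g unfolding rectangular_grid_def by simp
qed

text \<open>Here \<open>a\<close> and \<open>b\<close> are the new and old values at one node,
  \<open>p\<close> and \<open>q\<close> the two parts of the reaction coefficient, and
  \<open>z\<close> the value of the convection and diffusion terms. The product \<open>z * a\<close>
  is kept on the left because its sign is controlled only after summation over all nodes.\<close>

lemma implicit_step_pointwise:
  fixes a b p q \<tau> m z :: real
  assumes "0 < \<tau>" and "m \<le> q" and "q \<le> 0" and "0 \<le> p"
    and eq: "(a - b) / \<tau> + (z + p * a) + q * b = 0"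
  shows "a\<^sup>2 + 2 * \<tau> * (z * a) \<le> (1 - m * \<tau>)\<^sup>2 * b\<^sup>2"
proof -
  have "a - b + \<tau> * (z + p * a + q * b) = 0"
    using eq \<open>0 < \<tau>\<close> by (simp add: field_simps)
  then have "a + \<tau> * z + \<tau> * p * a = (1 - q * \<tau>) * b"
    by (simp add: algebra_simps)
  then have "(a + \<tau> * z + \<tau> * p * a) * a = ((1 - q * \<tau>) * b) * a"
    by simp
  moreover have "0 \<le> \<tau> * p * a\<^sup>2"
    using assms by simp
  \<comment> \<open>Doubling the previous identity produces \<open>2 * a\<^sup>2\<close>; one copy
    of \<open>a\<^sup>2\<close> absorbs the one on the right here, the other survives.\<close>
  moreover have "2 * (((1 - q * \<tau>) * b) * a) \<le> ((1 - q * \<tau>) * b)\<^sup>2 + a\<^sup>2"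
    using sum_squares_bound[of "(1 - q * \<tau>) * b" a] by simp
  ultimately have "a\<^sup>2 + 2 * \<tau> * (z * a) \<le> ((1 - q * \<tau>) * b)\<^sup>2"
    by (simp add: power2_eq_square algebra_simps)
  also have "\<dots> \<le> (1 - m * \<tau>)\<^sup>2 * b\<^sup>2"
  proof -
    have "0 \<le> 1 - q * \<tau>"
      using assms mult_nonpos_nonneg[of q \<tau>] by simp
    moreover have "1 - q * \<tau> \<le> 1 - m * \<tau>"
      using assms by simp
    ultimately show ?thesis
      unfolding power_mult_distrib by (intro mult_right_mono power_mono) auto
  qed
  finally show ?thesis .
qed

lemma explicit_implicit_step:
  assumes g: "rectangular_grid g" and "0 < \<tau>" and "m \<le> 0"
    and Y: "Y \<in> grid_space g"
    and "skew_symmetric g A"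
    and D: "0 \<le> grid_inner g (D Y) Y"
    and lower: "op_le g (scaled_id m) (mult_op c)"
    and eq: "\<And>x. x \<in> nodes g \<Longrightarrow>
      (Y x - w x) / \<tau> + (A Y x + D Y x + mult_op (pos_part c) Y x) + mult_op (neg_part c) w x = 0"
  shows "grid_norm g Y \<le> (1 - m * \<tau>) * grid_norm g w"
proof -
  have pointwise: "(Y x)\<^sup>2 + 2 * \<tau> * ((A Y x + D Y x) * Y x) \<le> (1 - m * \<tau>)\<^sup>2 * (w x)\<^sup>2"
    if "x \<in> nodes g" for x
  proof (rule implicit_step_pointwise)
    \<comment> \<open>\<open>neg_part c x\<close> is the minimum of 0 and \<open>c x\<close>, so the
      bound \<open>m \<le> c x\<close> passes to it because \<open>m \<le> 0\<close>.\<close>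
    show "m \<le> neg_part c x"
      using op_le_scaled_id_mult_opD[OF g lower that] \<open>m \<le> 0\<close>
      by (simp add: neg_part_def pos_part_def max_def)
    show "neg_part c x \<le> 0" and "0 \<le> pos_part c x"
      by (simp_all add: neg_part_def pos_part_def)
    show "(Y x - w x) / \<tau> + (A Y x + D Y x + pos_part c x * Y x) + neg_part c x * w x = 0"
      using eq[OF that] by (simp add: mult_op_def)
  qed fact
  have "grid_inner g Y Y + 2 * \<tau> * (grid_inner g (A Y) Y + grid_inner g (D Y) Y)
      = (\<Sum>x\<in>nodes g. ((Y x)\<^sup>2 + 2 * \<tau> * ((A Y x + D Y x) * Y x)) * (step1 g * step2 g))"
    unfolding grid_inner_def sum.distrib[symmetric] sum_distrib_left
    by (intro sum.cong) (auto simp: power2_eq_square algebra_simps)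
  also have "\<dots> \<le> (\<Sum>x\<in>nodes g. ((1 - m * \<tau>)\<^sup>2 * (w x)\<^sup>2) * (step1 g * step2 g))"
    using g pointwise by (intro sum_mono mult_right_mono) (auto simp: rectangular_grid_def)
  also have "\<dots> = (1 - m * \<tau>)\<^sup>2 * grid_inner g w w"
    unfolding grid_inner_def sum_distrib_left by (simp add: power2_eq_square mult.assoc)
  finally have "grid_inner g Y Y + 2 * \<tau> * grid_inner g (D Y) Y \<le> (1 - m * \<tau>)\<^sup>2 * grid_inner g w w"
    using skew_symmetric_inner_eq_0[OF \<open>skew_symmetric g A\<close> Y] by simp
  moreover have "0 \<le> 2 * \<tau> * grid_inner g (D Y) Y"
    using D \<open>0 < \<tau>\<close> by simp
  ultimately have "grid_inner g Y Y \<le> (1 - m * \<tau>)\<^sup>2 * grid_inner g w w"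
    by linarith
  then have "grid_norm g Y \<le> sqrt ((1 - m * \<tau>)\<^sup>2 * grid_inner g w w)"
    unfolding grid_norm_def by (rule real_sqrt_le_mono)
  \<comment> \<open>The root of the square is an absolute value, removed because
    \<open>m * \<tau> \<le> 0\<close> makes the factor positive.\<close>
  also have "\<dots> = (1 - m * \<tau>) * grid_norm g w"
    using \<open>0 < \<tau>\<close> \<open>m \<le> 0\<close> mult_nonpos_nonneg[of m \<tau>]
    by (simp add: grid_norm_def real_sqrt_mult)
  finally show ?thesis .
qed

text \<open>Follows from 1 + s \<le> exp s with \<open>s = - m * \<tau>\<close>. As s is
  nonnegative, raising the exponent from \<open>n\<close> to \<open>N\<close> only enlarges the
  bound, which then depends on \<open>\<tau>\<close> and \<open>N\<close> solely through their
  product.\<close>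

lemma power_growth_factor_le_exp:
  fixes m \<tau> :: real
  assumes "0 \<le> \<tau>" and "m \<le> 0" and "n \<le> N"
  shows "(1 - m * \<tau>) ^ n \<le> exp (- m * (real N * \<tau>))"
proof -
  have "0 \<le> - m * \<tau>"
    using assms mult_nonpos_nonneg[of m \<tau>] by simp
  then have "(1 - m * \<tau>) ^ n \<le> exp (- m * \<tau>) ^ n"
    using exp_ge_add_one_self[of "- m * \<tau>"] by (intro power_mono) auto
  also have "\<dots> \<le> exp (- m * \<tau>) ^ N"
    using \<open>0 \<le> - m * \<tau>\<close> \<open>n \<le> N\<close> by (intro power_increasing) auto
  also have "\<dots> = exp (- m * (real N * \<tau>))"
    by (simp add: exp_of_nat_mult[symmetric] mult.left_commute)
  finally show ?thesis .
qed

theorem theorem21: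
  fixes g :: rect_grid
    and T \<kappa>1 M0 m M :: real
    and C :: "real \<Rightarrow> nat \<Rightarrow> grid_op"
    and D :: grid_op
    and r :: "real \<times> real \<Rightarrow> real \<Rightarrow> real"
    and t :: "real \<Rightarrow> nat \<Rightarrow> real"
  defines "\<rho> \<equiv> (\<lambda>\<tau>::real. 1 - m * \<tau>)"
    and "rn \<equiv> (\<lambda>\<tau> n x. r x (t \<tau> n))"
  assumes "rectangular_grid g"
    and "0 < T" and "0 < \<kappa>1" and "0 < M0" and "m < 0"
    and "linear_operator g D" and "self_adjoint g D"
    and "op_le g (scaled_id (\<kappa>1 / M0)) D"
    and "\<And>\<tau> n. 0 < \<tau> \<Longrightarrow> real n * \<tau> < T \<Longrightarrow> linear_operator g (C \<tau> n)"
    and "\<And>\<tau> n. 0 < \<tau> \<Longrightarrow> real n * \<tau> < T \<Longrightarrow> skew_symmetric g (C \<tau> n)"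
    and "\<And>\<tau> n. 0 < \<tau> \<Longrightarrow> real n * \<tau> < T \<Longrightarrow> op_le g (scaled_id m) (mult_op (rn \<tau> n))"
    and "\<And>\<tau> n. 0 < \<tau> \<Longrightarrow> real n * \<tau> < T \<Longrightarrow> op_le g (mult_op (rn \<tau> n)) (scaled_id M)"
  shows "unconditionally_rho_stable g T \<rho> (explicit_implicit_solution g C D rn)
    \<and> (\<forall>\<tau>>0. \<forall>N0. real N0 * \<tau> = T \<longrightarrow>
         (\<forall>u0\<in>grid_space g. \<forall>y. explicit_implicit_solution g C D rn \<tau> N0 u0 y \<longrightarrow>
            (\<forall>n<N0. grid_norm g (y (n + 1)) \<le> \<rho> \<tau> * grid_norm g (y n))))"
proof -
  have step: "grid_norm g (y (n + 1)) \<le> \<rho> \<tau> * grid_norm g (y n)"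
    if "0 < \<tau>" and N: "real N * \<tau> = T" and "n < N"
      and y: "explicit_implicit_solution g C D rn \<tau> N u y" for \<tau> N n u y
  proof -
    \<comment> \<open>The hypotheses on \<open>C\<close> and \<open>r\<close> cover times strictly
      before \<open>T\<close>; the strict inequality \<open>n < N\<close> places every step of the
      scheme there.\<close>
    have t: "real n * \<tau> < T"
      using \<open>0 < \<tau>\<close> \<open>n < N\<close> by (simp add: N[symmetric])
    have Y: "y (n + 1) \<in> grid_space g"
      using y \<open>n < N\<close> by (simp add: explicit_implicit_solution_def)
    show ?thesis
      unfolding \<rho>_def
    proof (rule explicit_implicit_step)
      show "0 \<le> grid_inner g (D (y (n + 1))) (y (n + 1))"
        using op_le_scaled_id_nonneg[OF _ _ \<open>op_le g (scaled_id (\<kappa>1 / M0)) D\<close> Y] assms(3,5,6)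
        by simp
      show "skew_symmetric g (C \<tau> n)" and "op_le g (scaled_id m) (mult_op (rn \<tau> n))"
        using assms(12,13)[OF \<open>0 < \<tau>\<close> t] by simp_all
      show "(y (n + 1) x - y n x) / \<tau>
          + (C \<tau> n (y (n + 1)) x + D (y (n + 1)) x + mult_op (pos_part (rn \<tau> n)) (y (n + 1)) x)
          + mult_op (neg_part (rn \<tau> n)) (y n) x = 0" if "x \<in> nodes g" for x
        using y \<open>n < N\<close> that unfolding explicit_implicit_solution_def by blast
    qed (use assms(3,7) \<open>0 < \<tau>\<close> Y in simp_all)
  qed
  have "\<rho> \<tau> ^ n \<le> exp (- m * T)" if "0 < \<tau>" "real N * \<tau> = T" "n \<le> N" for \<tau> N n
    using power_growth_factor_le_exp[of \<tau> m n N] that \<open>m < 0\<close> by (simp add: \<rho>_def)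
  then have "unconditionally_rho_stable g T \<rho> (explicit_implicit_solution g C D rn)"
    \<comment> \<open>Since \<open>real N * \<tau> = T\<close>, the witness
      \<open>exp (- m * T)\<close> can be fixed before \<open>\<tau>\<close>, \<open>N\<close> and
      \<open>n\<close>.\<close>
    unfolding unconditionally_rho_stable_def using step by (intro exI[of _ "exp (- m * T)"]) blast
  with step show ?thesis by blast
qed

end
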